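(* Let $n\ge 1$. Green's relation $\mathcal{H}$ on the additive semigroup $(A^+(B_n),+)$ is trivial, i.e. for $f,g\in A^+(B_n)$, $f\,\mathcal{H}\,g$ holds only if $f=g$.
   Context: For $n\ge 1$ let $[n]=\{1,\dots,n\}$. The Brandt semigroup $(B_n,+)$ has underlying set $B_n=([n]\times[n])\cup\{\vartheta\}$ with $(i,j)+(k,l)=(i,l)$ if $j=k$, $(i,j)+(k,l)=\vartheta$ if $j\ne k$, and $\alpha+\vartheta=\vartheta+\alpha=\vartheta$ for all $\alpha\in B_n$. $M(B_n)$ is the set of all maps $B_n\to B_n$; arguments are written on the left of functions. It carries pointwise addition $\alpha(f+g)=\alpha f+\alpha g$ and composition $\alpha(f\circ g)=(\alpha f)g$. An affine map over $B_n$ is a map of the form $g+h$ with $g$ an endomorphism of the semigroup $(B_n,+)$ (not required to fix $\vartheta$) and $h\in M(B_n)$ a constant map. $A^+(B_n)$ (the affine near-semiring over $B_n$) is the smallest subset of $M(B_n)$ that contains all affine maps and is closed under $+$ and $\circ$. *)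

theory Defs
  imports Main "HOL-Library.FuncSet"
begin

section \<open>The Brandt semigroup\<close>

text \<open>The addition is defined at once on all pairs of natural numbers together with
  \<open>Theta\<close>; the semigroup \<open>B\<^sub>n\<close> is the finite subset \<open>brandt_set n\<close>, which is
  closed under it.\<close>

datatype brandt = Pr nat nat | Theta

instantiation brandt :: semigroup_add
begin

fun plus_brandt :: "brandt \<Rightarrow> brandt \<Rightarrow> brandt" where
  "plus_brandt (Pr i j) (Pr k l) = (if j = k then Pr i l else Theta)"
| "plus_brandt Theta _ = Theta"
| "plus_brandt _ Theta = Theta"

instance
proof
  fix a b c :: brandt
  show "a + b + c = a + (b + c)"
    by (cases a; cases b; cases c) auto
qed

end

definition brandt_set :: "nat \<Rightarrow> brandt set" where
  "brandt_set n = {Pr i j | i j. i \<in> {1..n} \<and> j \<in> {1..n}} \<union> {Theta}"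

lemma brandt_set_add_closed:
  "a \<in> brandt_set n \<Longrightarrow> b \<in> brandt_set n \<Longrightarrow> a + b \<in> brandt_set n"
  by (cases a; cases b; simp add: brandt_set_def)

section \<open>Maps on the Brandt semigroup\<close>

text \<open>Extensional functions are used, so that equality of elements of \<open>brandt_maps n\<close> is
  equality of maps on \<open>B\<^sub>n\<close>. With arguments on the left, \<open>\<alpha>(f \<circ> g) = (\<alpha>f)g\<close>, so the product
  \<open>f \<circ> g\<close> of the near-semiring is \<open>compose (brandt_set n) g f\<close>.\<close>

definition brandt_maps :: "nat \<Rightarrow> (brandt \<Rightarrow> brandt) set" where
  "brandt_maps n = brandt_set n \<rightarrow>\<^sub>E brandt_set n"

definition pointwise_add ::
    "nat \<Rightarrow> (brandt \<Rightarrow> brandt) \<Rightarrow> (brandt \<Rightarrow> brandt) \<Rightarrow> brandt \<Rightarrow> brandt" where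
  "pointwise_add n f g = (\<lambda>a\<in>brandt_set n. f a + g a)"

definition seq_comp ::
    "nat \<Rightarrow> (brandt \<Rightarrow> brandt) \<Rightarrow> (brandt \<Rightarrow> brandt) \<Rightarrow> brandt \<Rightarrow> brandt" where
  "seq_comp n f g = compose (brandt_set n) g f"

definition brandt_endos :: "nat \<Rightarrow> (brandt \<Rightarrow> brandt) set" where
  "brandt_endos n =
    {g \<in> brandt_maps n. \<forall>a\<in>brandt_set n. \<forall>b\<in>brandt_set n. g (a + b) = g a + g b}"

definition constant_maps :: "nat \<Rightarrow> (brandt \<Rightarrow> brandt) set" where
  "constant_maps n = {\<lambda>a\<in>brandt_set n. c | c. c \<in> brandt_set n}"

definition affine_maps :: "nat \<Rightarrow> (brandt \<Rightarrow> brandt) set" where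
  "affine_maps n = {pointwise_add n g h | g h. g \<in> brandt_endos n \<and> h \<in> constant_maps n}"

inductive_set affine_near_semiring :: "nat \<Rightarrow> (brandt \<Rightarrow> brandt) set" for n :: nat where
  affine: "f \<in> affine_maps n \<Longrightarrow> f \<in> affine_near_semiring n"
| add: "f \<in> affine_near_semiring n \<Longrightarrow> g \<in> affine_near_semiring n \<Longrightarrow>
    pointwise_add n f g \<in> affine_near_semiring n"
| comp: "f \<in> affine_near_semiring n \<Longrightarrow> g \<in> affine_near_semiring n \<Longrightarrow>
    seq_comp n f g \<in> affine_near_semiring n"

lemma pointwise_add_closed:
  "f \<in> brandt_maps n \<Longrightarrow> g \<in> brandt_maps n \<Longrightarrow> pointwise_add n f g \<in> brandt_maps n"
  unfolding brandt_maps_def pointwise_add_def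
  by (simp add: PiE_iff brandt_set_add_closed)

lemma affine_near_semiring_subset_maps: "affine_near_semiring n \<subseteq> brandt_maps n"
proof
  fix f assume "f \<in> affine_near_semiring n"
  then show "f \<in> brandt_maps n"
  proof induction
    case (affine f)
    then obtain g h where "f = pointwise_add n g h" "g \<in> brandt_endos n" "h \<in> constant_maps n"
      unfolding affine_maps_def by blast
    moreover have "h \<in> brandt_maps n"
      using \<open>h \<in> constant_maps n\<close> unfolding constant_maps_def brandt_maps_def by force
    ultimately show ?case
      by (simp add: brandt_endos_def pointwise_add_closed)
  next
    case (add f g)
    then show ?case by (simp add: pointwise_add_closed)
  next
    case (comp f g)
    then show ?case by (simp add: seq_comp_def brandt_maps_def compose_def PiE_iff extensional_def)
  qed
qed

section \<open>Green's relations\<close>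

text \<open>For a semigroup with carrier \<open>S\<close> and operation \<open>op\<close>, the set \<open>{a} \<union> aS\<close> is the
  principal right ideal \<open>aS\<^sup>1\<close>, whether or not \<open>S\<close> already has an identity; dually
  for left ideals.\<close>

definition principal_right_ideal :: "'a set \<Rightarrow> ('a \<Rightarrow> 'a \<Rightarrow> 'a) \<Rightarrow> 'a \<Rightarrow> 'a set" where
  "principal_right_ideal S op a = {a} \<union> {op a s | s. s \<in> S}"

definition principal_left_ideal :: "'a set \<Rightarrow> ('a \<Rightarrow> 'a \<Rightarrow> 'a) \<Rightarrow> 'a \<Rightarrow> 'a set" where
  "principal_left_ideal S op a = {a} \<union> {op s a | s. s \<in> S}"

definition green_R :: "'a set \<Rightarrow> ('a \<Rightarrow> 'a \<Rightarrow> 'a) \<Rightarrow> 'a rel" where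
  "green_R S op = {(a, b). a \<in> S \<and> b \<in> S \<and>
    principal_right_ideal S op a = principal_right_ideal S op b}"

definition green_L :: "'a set \<Rightarrow> ('a \<Rightarrow> 'a \<Rightarrow> 'a) \<Rightarrow> 'a rel" where
  "green_L S op = {(a, b). a \<in> S \<and> b \<in> S \<and>
    principal_left_ideal S op a = principal_left_ideal S op b}"

definition green_H :: "'a set \<Rightarrow> ('a \<Rightarrow> 'a \<Rightarrow> 'a) \<Rightarrow> 'a rel" where
  "green_H S op = green_R S op \<inter> green_L S op"

end

theory Submission
  imports Defs
begin

text \<open>The Brandt semigroup is itself \<open>\<H>\<close>-trivial: left and right divisors of a nonzero pair
  determine its two coordinates. Since addition of maps is pointwise, this passes to every
  additive semigroup of maps, whatever its elements look like.\<close>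

lemma plus_eq_Pr_iff:
  "x + y = Pr i j \<longleftrightarrow> (\<exists>k. x = Pr i k \<and> y = Pr k j)"
  by (cases x; cases y) auto

lemma brandt_H_trivial:
  fixes x y :: brandt
  assumes "x = y + s" "y = x + t" "x = s' + y"
  shows "x = y"
proof (cases x)
  case (Pr i j)
  \<comment> \<open>A left summand of a nonzero sum shares its first coordinate, a right summand its
    second; \<open>y\<close> occurs as both.\<close>
  then obtain k where "y = Pr i k"
    using assms(1) plus_eq_Pr_iff[of y s i j] by auto
  moreover obtain l where "y = Pr l j"
    using Pr assms(3) plus_eq_Pr_iff[of s' y i j] by auto
  ultimately show ?thesis
    using Pr by simp
next
  \<comment> \<open>\<open>Theta\<close> is absorbing, so the reverse division
    \<open>y = x + t\<close> forces \<open>y = Theta\<close> too.\<close>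
  case Theta
  then show ?thesis
    using assms(2) by simp
qed

lemma green_R_sym: "(a, b) \<in> green_R S op \<Longrightarrow> (b, a) \<in> green_R S op"
  by (simp add: green_R_def)

text \<open>Equal principal ideals put \<open>a\<close> in \<open>{b} \<union> bS\<close>;
  distinctness excludes the adjoined identity as the factor, leaving a genuine equation.\<close>

lemma green_R_divides:
  assumes "(a, b) \<in> green_R S op" "a \<noteq> b"
  obtains s where "a = op b s"
proof -
  have "a \<in> principal_right_ideal S op a"
    by (simp add: principal_right_ideal_def)
  then have "a \<in> principal_right_ideal S op b"
    using assms(1) by (simp add: green_R_def)
  then show thesis
    using assms(2) that by (auto simp: principal_right_ideal_def)
qed

lemma green_L_divides:
  assumes "(a, b) \<in> green_L S op" "a \<noteq> b"
  obtains s where "a = op s b"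
proof -
  have "a \<in> principal_left_ideal S op a"
    by (simp add: principal_left_ideal_def)
  then have "a \<in> principal_left_ideal S op b"
    using assms(1) by (simp add: green_L_def)
  then show thesis
    using assms(2) that by (auto simp: principal_left_ideal_def)
qed

lemma green_H_refl: "a \<in> S \<Longrightarrow> (a, a) \<in> green_H S op"
  by (simp add: green_H_def green_R_def green_L_def)

lemma green_H_pointwise_add_trivial:
  assumes "S \<subseteq> brandt_maps n" "(f, g) \<in> green_H S (pointwise_add n)"
  shows "f = g"
proof (rule ccontr)
  \<comment> \<open>Assuming the maps distinct turns Green's relations into actual factors
    \<open>s\<close>, \<open>t\<close> and \<open>s'\<close>.\<close>
  assume ne: "f \<noteq> g"
  have R: "(f, g) \<in> green_R S (pointwise_add n)" and L: "(f, g) \<in> green_L S (pointwise_add n)"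
    using assms(2) by (auto simp: green_H_def)
  obtain s where s: "f = pointwise_add n g s"
    using green_R_divides[OF R ne] .
  obtain t where t: "g = pointwise_add n f t"
    using green_R_divides[OF green_R_sym[OF R] ne[symmetric]] .
  obtain s' where s': "f = pointwise_add n s' g"
    using green_L_divides[OF L ne] .
  have "f \<in> brandt_maps n" "g \<in> brandt_maps n"
    using R assms(1) by (auto simp: green_R_def)
  then have "f = g"
    unfolding brandt_maps_def
  \<comment> \<open>Both maps are extensional, so agreement on \<open>brandt_set n\<close> suffices;
    evaluation at a point carries the three factorisations into the Brandt semigroup.\<close>
  proof (rule PiE_ext)
    fix a assume "a \<in> brandt_set n"
    then have add: "pointwise_add n p q a = p a + q a" for p q
      by (simp add: pointwise_add_def)
    have "f a = g a + s a" "g a = f a + t a" "f a = s' a + g a"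
      using s[THEN fun_cong, of a] t[THEN fun_cong, of a] s'[THEN fun_cong, of a] unfolding add .
    then show "f a = g a"
      by (rule brandt_H_trivial)
  qed
  with ne show False ..
qed

theorem proposition3p10:
  fixes n :: nat
  assumes "n \<ge> 1"
  shows "green_H (affine_near_semiring n) (pointwise_add n) = Id_on (affine_near_semiring n)"
proof
  show "green_H (affine_near_semiring n) (pointwise_add n) \<subseteq> Id_on (affine_near_semiring n)"
    using green_H_pointwise_add_trivial[OF affine_near_semiring_subset_maps]
    by (auto simp: Id_on_iff green_H_def green_R_def)
  \<comment> \<open>Reflexivity on the carrier gives the converse inclusion.\<close>
  show "Id_on (affine_near_semiring n) \<subseteq> green_H (affine_near_semiring n) (pointwise_add n)"
    using green_H_refl by (auto simp: Id_on_iff)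
qed

end
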